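(* Let $n$ be a positive integer and let $\alpha,\beta>0$ be such that $(a_1,a_2,a_3,a_4)=(-1,1,\alpha+\mathrm{i}\beta,\alpha-\mathrm{i}\beta)$ is a $\mathbf{T}_n$-tuple with associated polynomial $\mathcal{T}_n$. Let $\widetilde{a_3a_4}$ be the Jordan arc, symmetric with respect to the real line, with endpoints $a_3$ and $a_4$, such that $\mathcal{T}_n^{-1}([-1,1])=[-1,1]\cup\widetilde{a_3a_4}$. If $\alpha\le1$, then the two arcs $\widetilde{a_3a_4}$ and $[-1,1]$ intersect each other.
   Context: Four pairwise distinct points $a_1,a_2,a_3,a_4\in\mathbb{C}$ are called a $\mathbf{T}_n$-tuple if there exist a complex polynomial $\mathcal{T}_n$ of degree $n$ and a complex polynomial $\mathcal{U}_{n-2}$ of degree $n-2$ such that $\mathcal{T}_n^2(z)-\mathcal{H}(z)\,\mathcal{U}_{n-2}^2(z)=1$, where $\mathcal{H}(z)=(z-a_1)(z-a_2)(z-a_3)(z-a_4)$; $\mathcal{T}_n$ (the associated polynomial) and $\mathcal{U}_{n-2}$ are then unique up to sign. $\mathcal{T}_n^{-1}([-1,1])=\{z\in\mathbb{C}:\mathcal{T}_n(z)\in[-1,1]\}$. Known background facts: there are unique $0<k<1$, $0<\lambda<\frac12$ with $\alpha=\frac{\operatorname{cn}(2\lambda K)}{\operatorname{dn}^2(2\lambda K)}$, $\beta=\frac{kk'\operatorname{sn}^2(2\lambda K)}{\operatorname{dn}^2(2\lambda K)}$ (Jacobi elliptic functions of modulus $k$, $k'=\sqrt{1-k^2}$,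 $K=K(k)$ the complete elliptic integral of the first kind, $E=E(k)$ that of the second kind), and the tuple is a $\mathbf{T}_n$-tuple if and only if $\lambda=\frac mn$ for some positive integer $m$. In this case $\mathcal{T}_n^{-1}([-1,1])$ consists of $[-1,1]$ and a Jordan arc $\widetilde{a_3a_4}$ symmetric with respect to the real line with endpoints $a_3,a_4$. The point $z^*$ defined by $\mathcal{T}_n'(z)=\pm n(z-z^* )\,\mathcal{U}_{n-2}(z)$ is $z^*=1+\frac{1}{\operatorname{dn}(2\lambda K)}\bigl(\operatorname{cn}(2\lambda K)-1+2\operatorname{sn}(2\lambda K)\operatorname{zn}(\lambda K)\bigr)>0$, where $\operatorname{zn}(u)=\int_0^u\operatorname{dn}^2(t)\,dt-\frac EK u$; if $z^*\le1$ then $\widetilde{a_3a_4}$ crosses $[-1,1]$ at $z^*$, and if $z^*>1$ the two arcs are non-intersecting. *)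

theory Defs
  imports "HOL-Analysis.Analysis" "HOL-Computational_Algebra.Polynomial"
begin

definition quartic_poly :: "complex \<Rightarrow> complex \<Rightarrow> complex \<Rightarrow> complex \<Rightarrow> complex poly" where
  "quartic_poly a1 a2 a3 a4 = [:-a1, 1:] * [:-a2, 1:] * [:-a3, 1:] * [:-a4, 1:]"

(* The degree condition deg U = n - 2 is written deg U + 2 = n because natural-number
   subtraction truncates; U \<noteq> 0 is stated because degree 0 = 0 for the zero polynomial. *)
definition T_associated_poly ::
  "nat \<Rightarrow> complex \<Rightarrow> complex \<Rightarrow> complex \<Rightarrow> complex \<Rightarrow> complex poly \<Rightarrow> bool" where
  "T_associated_poly n a1 a2 a3 a4 T \<longleftrightarrow>
     degree T = n \<and>
     (\<exists>U. U \<noteq> 0 \<and> degree U + 2 = n \<and> T ^ 2 - quartic_poly a1 a2 a3 a4 * U ^ 2 = 1)"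

definition T_tuple :: "nat \<Rightarrow> complex \<Rightarrow> complex \<Rightarrow> complex \<Rightarrow> complex \<Rightarrow> bool" where
  "T_tuple n a1 a2 a3 a4 \<longleftrightarrow>
     distinct [a1, a2, a3, a4] \<and> (\<exists>T. T_associated_poly n a1 a2 a3 a4 T)"

end

theory Submission
  imports Defs
begin

text \<open>
  The equation \<open>T\<^sup>2 - H U\<^sup>2 = 1\<close> forces \<open>T' = c (z - z\<^sup>*) U\<close> with \<open>c\<close> and \<open>z\<^sup>*\<close> real. On the vertical
  segment from \<open>\<alpha>\<close> to \<open>\<alpha> + \<i> \<beta>\<close> the function \<open>\<Phi> = T + sqrt (T\<^sup>2 - 1)\<close> has logarithmic derivative
  \<open>T' / sqrt (T\<^sup>2 - 1) = c (z - z\<^sup>*) / sqrt H\<close>, and \<open>\<bar>\<Phi>\<bar> = 1\<close> at both ends, because \<open>\<alpha> \<in> [-1,1]\<close>. Following the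
  argument of \<open>(z - z\<^sup>*) / sqrt H\<close> shows that \<open>\<bar>\<Phi>\<bar>\<close> would be strictly monotone on the segment if
  \<open>z\<^sup>*\<close> lay outside \<open>[-1,1]\<close>; hence \<open>z\<^sup>* \<in> [-1,1]\<close>. On the other hand, if the arc missed \<open>[-1,1]\<close>, it
  would cross the real line at some \<open>x\<^sub>0\<close> outside \<open>[-1,1]\<close>. There \<open>T\<^sup>2 = 1\<close>, while \<open>T\<^sup>2 \<ge> 1\<close> on the whole
  real line outside \<open>(-1,1)\<close>, so \<open>T\<^sup>2\<close> has a maximum with value \<open>> 1\<close> between \<open>x\<^sub>0\<close> and the nearer of \<open>\<plusminus>1\<close>.
  At this maximum \<open>U \<noteq> 0\<close> and \<open>T' = 0\<close>, so it is \<open>z\<^sup>*\<close>, which is a contradiction.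
\<close>

section \<open>Factoring the derivative in the Pell equation\<close>

text \<open>Differentiating the equation shows that \<open>U\<close> divides \<open>2 T T'\<close>.
  Multiplying \<open>T'\<close> by \<open>1 = T^2 - H U^2\<close> turns this into divisibility of
  \<open>T'\<close> itself, with an explicit cofactor \<open>L\<close>. The second identity serves
  to differentiate \<open>\<Phi>\<close>.\<close>

lemma pell_pderiv_factor:
  fixes T H U :: "complex poly"
  assumes pell: "T ^ 2 - H * U ^ 2 = 1" and "U \<noteq> 0"
  obtains L where "pderiv T = U * L" "smult 2 (T * L) = pderiv H * U + smult 2 (H * pderiv U)"
proof -
  have "pderiv (T ^ 2 - H * U ^ 2) = 0"
    by (simp add: pell)
  then have d: "smult 2 (T * pderiv T) = U * (pderiv H * U + smult 2 (H * pderiv U))"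
    by (simp add: pderiv_diff pderiv_mult power2_eq_square algebra_simps numeral_poly)
  define R where "R = pderiv H * U + smult 2 (H * pderiv U)"
  define L where "L = smult (1/2) (T * R) - pderiv T * H * U"
  have "pderiv T = pderiv T * (T ^ 2 - H * U ^ 2)"
    by (simp add: pell)
  also have "\<dots> = smult (1/2) (T * smult 2 (T * pderiv T)) - pderiv T * H * U ^ 2"
    by (simp add: algebra_simps power2_eq_square)
  also have "\<dots> = U * L"
    unfolding d L_def R_def[symmetric] by (simp add: algebra_simps power2_eq_square)
  finally have L: "pderiv T = U * L" .
  have "U * smult 2 (T * L) = U * R"
    using d unfolding L R_def by (simp add: algebra_simps)
  then have "smult 2 (T * L) = R"
    using \<open>U \<noteq> 0\<close> by (metis mult_left_cancel)
  with L show thesis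
    unfolding R_def by (rule that)
qed

section \<open>Polynomials with real coefficients\<close>

text \<open>Invariance under \<open>map_poly cnj\<close> encodes real coefficients. The difference
  of the two polynomials vanishes on \<open>S\<close>, hence has infinitely many roots.\<close>

lemma real_on_infinite_imp_cnj_eq:
  fixes p :: "complex poly"
  assumes "infinite S" and "\<And>x. x \<in> S \<Longrightarrow> x \<in> \<real> \<and> poly p x \<in> \<real>"
  shows "map_poly cnj p = p"
proof (rule ccontr)
  assume "map_poly cnj p \<noteq> p"
  then have "finite {x. poly (map_poly cnj p - p) x = 0}"
    by (intro poly_roots_finite) simp
  moreover have "S \<subseteq> {x. poly (map_poly cnj p - p) x = 0}"
    using assms(2) by (auto simp: Reals_cnj_iff)
  ultimately show False
    using \<open>infinite S\<close> finite_subset by blast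
qed

lemma map_poly_cnj_mult: "map_poly cnj (p * q) = map_poly cnj p * map_poly cnj q"
  by (rule poly_ext) simp

lemma map_poly_cnj_pderiv: "map_poly cnj (pderiv p) = pderiv (map_poly cnj p)"
  by (rule poly_eqI) (simp add: coeff_map_poly coeff_pderiv)

lemma cnj_fixed_poly_Reals:
  assumes "map_poly cnj p = p" and "x \<in> \<real>"
  shows "poly p x \<in> \<real>"
  using assms poly_cnj[of p x] by (simp add: Reals_cnj_iff)

section \<open>The square root and the function \<open>\<Phi>\<close>\<close>

text \<open>The point 0 lies on the branch cut, yet \<open>csqrt\<close> is continuous there because
  its modulus is the square root of the modulus. This covers the ends of the vertical segment, where
  \<open>H\<close> may vanish.\<close>

lemma isCont_csqrt_Re_nonneg:
  assumes "continuous (at x within A) f" and "Re (f x) > 0 \<or> f x = 0"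
  shows "continuous (at x within A) (\<lambda>x. csqrt (f x))"
proof (cases "f x = 0")
  case True
  have "((\<lambda>t. sqrt (norm (f t))) \<longlongrightarrow> sqrt (norm (f x))) (at x within A)"
    using assms(1) unfolding continuous_within by (intro tendsto_intros)
  then have "((\<lambda>t. norm (csqrt (f t))) \<longlongrightarrow> 0) (at x within A)"
    using True by (simp del: csqrt.simps)
  then show ?thesis
    using True unfolding continuous_within
    by (simp add: tendsto_norm_zero_cancel del: csqrt.simps)
next
  case False
  then have "f x \<notin> \<real>\<^sub>\<le>\<^sub>0"
    using assms(2) by (auto simp: complex_nonpos_Reals_iff)
  then show ?thesis
    by (intro continuous_within_compose2[OF assms(1)] continuous_within_csqrt)
qed

text \<open>
  Writing \<open>sqrt (T\<^sup>2 - 1)\<close> as \<open>\<i> * csqrt (- H) * U\<close> keeps the branch cut of \<open>csqrt\<close> away from the vertical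
  segment, where \<open>Re (- H) > 0\<close>.
\<close>
lemma pell_exponential_deriv:
  fixes T H U L :: "complex poly"
  assumes L: "pderiv T = U * L" "smult 2 (T * L) = pderiv H * U + smult 2 (H * pderiv U)"
    and z: "- poly H z \<notin> \<real>\<^sub>\<le>\<^sub>0"
  defines "\<Phi> \<equiv> \<lambda>z. poly T z + \<i> * csqrt (- poly H z) * poly U z"
  shows "(\<Phi> has_field_derivative (- \<i> * poly L z / csqrt (- poly H z)) * \<Phi> z) (at z)"
proof -
  define r where "r = csqrt (- poly H z)"
  have r2: "r * r = - poly H z"
    unfolding r_def by (metis power2_csqrt power2_eq_square)
  have r0: "r \<noteq> 0"
    using z by (auto simp: r_def)
  have e: "2 * (poly T z * poly L z) = poly (pderiv H) z * poly U z + 2 * (poly H z * poly (pderiv U) z)"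
    using arg_cong[OF L(2), of "\<lambda>p. poly p z"] by simp
  have "(\<Phi> has_field_derivative
      poly (pderiv T) z + (\<i> * (- poly (pderiv H) z / (2 * r)) * poly U z + \<i> * r * poly (pderiv U) z)) (at z)"
    unfolding \<Phi>_def r_def using z
    by (auto intro!: derivative_eq_intros)
  moreover have "poly (pderiv T) z + (\<i> * (- poly (pderiv H) z / (2 * r)) * poly U z + \<i> * r * poly (pderiv U) z)
      = (- \<i> * poly L z / r) * (poly T z + \<i> * r * poly U z)"
  proof -
    \<comment> \<open>The second identity eliminates \<open>H' U\<close>; the terms with
      \<open>U'\<close> then cancel.\<close>
    have "poly (pderiv H) z * poly U z = 2 * (poly T z * poly L z) + 2 * (r * r * poly (pderiv U) z)"
      unfolding r2 e by simp
    then have HU: "\<i> * (- poly (pderiv H) z / (2 * r)) * poly U z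
        = - \<i> * (2 * (poly T z * poly L z) + 2 * (r * r * poly (pderiv U) z)) / (2 * r)"
      by (metis (no_types, opaque_lifting) minus_divide_left minus_mult_commute mult.assoc mult.commute times_divide_eq_left)
    show ?thesis
      unfolding HU L(1) using r0 by (simp add: field_simps)
  qed
  ultimately show ?thesis
    unfolding r_def \<Phi>_def by simp
qed

section \<open>The quartic on the vertical segment\<close>

definition tuple_quartic :: "real \<Rightarrow> real \<Rightarrow> complex poly" where
  "tuple_quartic \<alpha> \<beta> = quartic_poly (-1) 1 (Complex \<alpha> \<beta>) (Complex \<alpha> (-\<beta>))"

lemma poly_tuple_quartic_vertical:
  "- poly (tuple_quartic \<alpha> \<beta>) (Complex \<alpha> y)
    = Complex ((1 - \<alpha>\<^sup>2 + y\<^sup>2) * (\<beta>\<^sup>2 - y\<^sup>2)) (- 2 * \<alpha> * y * (\<beta>\<^sup>2 - y\<^sup>2))"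
  by (simp add: tuple_quartic_def quartic_poly_def complex_eq_iff power2_eq_square algebra_simps)

lemma poly_tuple_quartic_real:
  "poly (tuple_quartic \<alpha> \<beta>) (of_real x) = of_real ((x\<^sup>2 - 1) * ((x - \<alpha>)\<^sup>2 + \<beta>\<^sup>2))"
  by (simp add: tuple_quartic_def quartic_poly_def complex_eq_iff power2_eq_square algebra_simps)

text \<open>Rolle's theorem applies to \<open>N\<close>, the squared modulus of
  \<open>\<Phi>\<close> along the segment: it equals 1 at both ends, and its logarithmic derivative
  is twice the real part in the conclusion.\<close>

lemma vertical_segment_stationary:
  fixes T U L :: "complex poly" and \<alpha> \<beta> :: real
  defines "H \<equiv> tuple_quartic \<alpha> \<beta>"
  assumes pell: "T ^ 2 - H * U ^ 2 = 1"
    and L: "pderiv T = U * L" "smult 2 (T * L) = pderiv H * U + smult 2 (H * pderiv U)"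
    and T: "map_poly cnj T = T" and U: "map_poly cnj U = U"
    and \<alpha>: "0 < \<alpha>" "\<alpha> \<le> 1" and \<beta>: "0 < \<beta>"
  obtains y where "0 < y" "y < \<beta>"
    "Re (poly L (Complex \<alpha> y) / csqrt (- poly H (Complex \<alpha> y))) = 0"
proof -
  define w where "w y = of_real \<alpha> + of_real y * \<i>" for y
  have w: "w y = Complex \<alpha> y" for y by (simp add: w_def complex_eq_iff)
  define r where "r y = csqrt (- poly H (w y))" for y
  define \<Phi> where "\<Phi> z = poly T z + \<i> * csqrt (- poly H z) * poly U z" for z
  \<comment> \<open>The product of \<open>\<Phi>\<close> with the expression for the opposite root
    is \<open>T^2 - H U^2 = 1\<close>.\<close>
  have \<Phi>0: "\<Phi> z \<noteq> 0" for z
  proof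
    assume "\<Phi> z = 0"
    then have "0 = \<Phi> z * (poly T z - \<i> * csqrt (- poly H z) * poly U z)"
      by simp
    also have "\<dots> = poly T z ^ 2 + (csqrt (- poly H z))\<^sup>2 * poly U z ^ 2"
      by (simp add: \<Phi>_def algebra_simps power2_eq_square)
    also have "\<dots> = poly (T ^ 2 - H * U ^ 2) z"
      by simp
    finally show False
      by (simp add: pell)
  qed
  define N where "N y = (Re (\<Phi> (w y)))\<^sup>2 + (Im (\<Phi> (w y)))\<^sup>2" for y
  have slit: "Re (- poly H (w y)) > 0" if "0 < y" "y < \<beta>" for y
  proof -
    have "\<alpha>\<^sup>2 \<le> 1" "0 < y\<^sup>2" "y\<^sup>2 < \<beta>\<^sup>2"
      using \<alpha> that by (simp_all add: power_le_one power_strict_mono)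
    then show ?thesis
      unfolding H_def w poly_tuple_quartic_vertical by (simp add: add_nonneg_pos)
  qed
  \<comment> \<open>\<open>H\<close> vanishes at \<open>y = \<beta>\<close>, and also at
    \<open>y = 0\<close> when \<open>\<alpha> = 1\<close>.\<close>
  have ends: "Re (- poly H (w y)) > 0 \<or> - poly H (w y) = 0" if "y \<in> {0..\<beta>}" for y
  proof -
    have "0 < 1 - \<alpha>\<^sup>2 \<or> \<alpha> = 1"
      using \<alpha> by (cases "\<alpha> = 1") (auto simp: power_strict_mono[of \<alpha> 1 2, simplified])
    then consider "0 < y" "y < \<beta>" | "y = \<beta>" | "y = 0" "0 < 1 - \<alpha>\<^sup>2" | "y = 0" "\<alpha> = 1"
      using \<open>y \<in> {0..\<beta>}\<close> by force
    then show ?thesis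
    proof cases
      case 1 then show ?thesis using slit by blast
    next
      case 2 then show ?thesis unfolding H_def w poly_tuple_quartic_vertical by (simp add: complex_eq_iff)
    next
      case 3 then show ?thesis using \<beta> unfolding H_def w poly_tuple_quartic_vertical by simp
    next
      case 4 then show ?thesis unfolding H_def w poly_tuple_quartic_vertical by (simp add: complex_eq_iff)
    qed
  qed
  have cw: "continuous (at y within A) w" for y A
    unfolding w_def by (intro continuous_intros)
  have cp: "continuous (at y within A) (\<lambda>y. poly p (w y))" for y A and p :: "complex poly"
    using cw by (rule continuous_within_compose2) (simp add: continuous_at_imp_continuous_at_within)
  have "continuous_on {0..\<beta>} (\<lambda>y. \<Phi> (w y))"
    unfolding \<Phi>_def continuous_on_eq_continuous_within
    by (intro ballI continuous_add continuous_mult continuous_const continuous_minus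
        cp isCont_csqrt_Re_nonneg ends)
  then have contN: "continuous_on {0..\<beta>} N"
    unfolding N_def by (intro continuous_intros)
  have derN: "(N has_real_derivative 2 * N y * Re (poly L (w y) / r y)) (at y)"
    if y: "0 < y" "y < \<beta>" for y
  proof -
    have "- poly H (w y) \<notin> \<real>\<^sub>\<le>\<^sub>0"
      using slit[OF y] by (auto simp: complex_nonpos_Reals_iff)
    then have d: "(\<Phi> has_field_derivative (- \<i> * poly L (w y) / r y) * \<Phi> (w y)) (at (w y))"
      unfolding \<Phi>_def r_def using L by (intro pell_exponential_deriv)
    define D where "D = poly L (w y) / r y"
    \<comment> \<open>The velocity \<open>\<i>\<close> of \<open>w\<close> cancels the factor
      \<open>- \<i>\<close> in the logarithmic derivative of \<open>\<Phi>\<close>.\<close>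
    have "(w has_vector_derivative \<i>) (at y)"
      unfolding w_def by (auto intro!: derivative_eq_intros simp: has_vector_derivative_def scaleR_conv_of_real)
    from field_vector_diff_chain_at[OF this d]
    have v: "((\<lambda>y. \<Phi> (w y)) has_vector_derivative D * \<Phi> (w y)) (at y)"
      by (simp add: o_def D_def mult.assoc[symmetric])
    show ?thesis
      unfolding N_def D_def[symmetric]
      by (auto intro!: derivative_eq_intros v simp: power2_eq_square algebra_simps)
  qed
  have "N 0 = 1"
  proof -
    have w0: "w 0 = of_real \<alpha>" by (simp add: w_def)
    have "poly T (of_real \<alpha>) \<in> \<real>" "poly U (of_real \<alpha>) \<in> \<real>"
      using T U cnj_fixed_poly_Reals by auto
    then obtain t u where tu: "poly T (of_real \<alpha>) = of_real t" "poly U (of_real \<alpha>) = of_real u"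
      by (auto elim!: Reals_cases)
    \<comment> \<open>Since \<open>- H\<close> takes the value \<open>h \<ge> 0\<close> at
      \<open>\<alpha>\<close>, its root is real there, and \<open>N 0\<close> becomes the left side
      of the Pell equation.\<close>
    define h where "h = (1 - \<alpha>\<^sup>2) * \<beta>\<^sup>2"
    have Hh: "poly H (of_real \<alpha>) = - of_real h"
      unfolding H_def h_def poly_tuple_quartic_real by (simp add: algebra_simps)
    have "h \<ge> 0"
      unfolding h_def using \<alpha> by (simp add: power_le_one)
    then have "csqrt (- poly H (of_real \<alpha>)) = of_real (sqrt h)"
      by (simp add: Hh)
    then have "\<Phi> (w 0) = of_real t + \<i> * of_real (sqrt h) * of_real u"
      unfolding \<Phi>_def w0 tu by simp
    then have "N 0 = t\<^sup>2 + h * u\<^sup>2"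
      unfolding N_def using \<open>h \<ge> 0\<close> by (simp add: power_mult_distrib)
    moreover have "poly (T ^ 2 - H * U ^ 2) (w 0) = of_real (t\<^sup>2 + h * u\<^sup>2)"
      using Hh tu by (simp add: w0)
    ultimately show ?thesis
      unfolding pell by (metis of_real_eq_1_iff poly_1)
  qed
  moreover have "N \<beta> = 1"
  proof -
    have H0: "poly H (w \<beta>) = 0"
      using poly_tuple_quartic_vertical[of \<alpha> \<beta> \<beta>] by (simp add: H_def w complex_eq_iff)
    then have "\<Phi> (w \<beta>) = poly T (w \<beta>)"
      by (simp add: \<Phi>_def)
    moreover have "poly (T ^ 2 - H * U ^ 2) (w \<beta>) = poly T (w \<beta>) ^ 2"
      by (simp add: H0)
    ultimately have "\<Phi> (w \<beta>) = 1 \<or> \<Phi> (w \<beta>) = -1"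
      unfolding pell by (simp add: power2_eq_1_iff)
    then show ?thesis
      unfolding N_def by auto
  qed
  ultimately have "N 0 = N \<beta>" by simp
  then obtain y where y: "0 < y" "y < \<beta>" "(N has_real_derivative 0) (at y)"
    using Rolle[of 0 \<beta> N] contN \<beta> derN real_differentiable_def by blast
  then have "2 * N y * Re (poly L (w y) / r y) = 0"
    using derN DERIV_unique by blast
  moreover have "N y \<noteq> 0"
    using \<Phi>0[of "w y"] by (simp add: N_def complex_eq_iff sum_power2_eq_zero_iff)
  ultimately show thesis
    using that[OF y(1,2)] by (simp add: w r_def)
qed

text \<open>With the root written as \<open>p + \<i> m\<close>, the real part has the sign of
  \<open>(\<alpha> - \<zeta>) p + y m\<close>, and the imaginary part of \<open>- H\<close> forces
  \<open>p > 0 > m\<close>.\<close>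

lemma Re_divide_sqrt_vertical_neq_0:
  assumes \<alpha>: "0 < \<alpha>" "\<alpha> \<le> 1" and y: "0 < y" "y < \<beta>" and \<zeta>: "\<zeta> < -1 \<or> \<zeta> > 1"
  shows "Re ((Complex \<alpha> y - of_real \<zeta>) / csqrt (- poly (tuple_quartic \<alpha> \<beta>) (Complex \<alpha> y))) \<noteq> 0"
proof -
  define v where "v = csqrt (- poly (tuple_quartic \<alpha> \<beta>) (Complex \<alpha> y))"
  define p m q where "p = Re v" and "m = Im v" and "q = \<beta>\<^sup>2 - y\<^sup>2"
  have q: "0 < q"
    using y by (simp add: q_def power_strict_mono)
  have "v\<^sup>2 = Complex ((1 - \<alpha>\<^sup>2 + y\<^sup>2) * q) (- 2 * \<alpha> * y * q)"
    unfolding v_def q_def by (simp add: poly_tuple_quartic_vertical)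
  then have re: "p * p - m * m = (1 - \<alpha>\<^sup>2 + y\<^sup>2) * q" and im: "p * m = - (\<alpha> * y * q)"
    by (simp_all add: complex_eq_iff p_def m_def power2_eq_square mult_ac)
  have "0 \<le> p"
    using csqrt_principal[of "- poly (tuple_quartic \<alpha> \<beta>) (Complex \<alpha> y)"]
    unfolding p_def v_def by linarith
  moreover have pm: "p * m < 0"
    using im \<alpha> y q by simp
  ultimately have p: "0 < p" and m: "m < 0"
    by (auto simp: mult_less_0_iff)
  have "(\<alpha> - \<zeta>) * p + y * m \<noteq> 0"
    using \<zeta>
  proof
    assume "\<zeta> > 1"
    then have "(\<alpha> - \<zeta>) * p < 0" "y * m < 0"
      using \<alpha> p y m by (simp_all add: mult_neg_pos mult_pos_neg)
    then show ?thesis by simp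
  next
    \<comment> \<open>The two terms now have opposite signs. Multiplying by \<open>p\<close> makes
      the second one \<open>- \<alpha> y^2 q\<close>, and \<open>y^2 q \<le> p^2\<close> shows that
      the first dominates.\<close>
    assume "\<zeta> < -1"
    have "\<alpha>\<^sup>2 \<le> 1" using \<alpha> by (simp add: power_le_one)
    then have "y\<^sup>2 * q \<le> p * p - m * m"
      unfolding re using q by (intro mult_right_mono) auto
    then have "y\<^sup>2 * q \<le> p * p"
      by (smt (verit) zero_le_square)
    then have "\<alpha> * (y\<^sup>2 * q) \<le> \<alpha> * (p * p)"
      using \<alpha> by (intro mult_left_mono) auto
    also have "\<dots> < (\<alpha> - \<zeta>) * (p * p)"
      using \<open>\<zeta> < -1\<close> p by (intro mult_strict_right_mono) auto
    finally have "0 < (\<alpha> - \<zeta>) * (p * p) + y * (p * m)"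
      unfolding im by (simp add: power2_eq_square algebra_simps)
    also have "\<dots> = p * ((\<alpha> - \<zeta>) * p + y * m)"
      by (simp add: algebra_simps)
    finally show ?thesis by auto
  qed
  moreover have "Re ((Complex \<alpha> y - of_real \<zeta>) / v) = ((\<alpha> - \<zeta>) * p + y * m) / (p\<^sup>2 + m\<^sup>2)"
    by (simp add: Re_divide p_def m_def)
  ultimately show ?thesis
    unfolding v_def[symmetric] using p by (simp add: sum_power2_eq_zero_iff)
qed

section \<open>Critical points on the real line\<close>

text \<open>A nonconstant \<open>T\<close> has \<open>T^2 = 1\<close> at only finitely many points,
  so the maximum of \<open>T^2\<close> exceeds 1 and is interior. There \<open>2 T T' = 0\<close>
  with \<open>T\<close> nonzero.\<close>

lemma real_interval_stationary:
  fixes T :: "complex poly" and a b :: real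
  assumes "a < b" and deg: "degree T > 0" and T: "map_poly cnj T = T"
    and ab: "(poly T (of_real a))\<^sup>2 = 1" "(poly T (of_real b))\<^sup>2 = 1"
    and ge: "\<And>x. a \<le> x \<Longrightarrow> x \<le> b \<Longrightarrow> 1 \<le> Re ((poly T (of_real x))\<^sup>2)"
  obtains x where "a < x" "x < b" "poly (pderiv T) (of_real x) = 0" "(poly T (of_real x))\<^sup>2 \<noteq> 1"
proof -
  define f where "f x = Re ((poly T (of_real x))\<^sup>2)" for x
  have f: "(poly T (of_real x))\<^sup>2 = of_real (f x)" for x
    using cnj_fixed_poly_Reals[OF T, of "of_real x"]
    by (auto simp: f_def elim!: Reals_cases simp flip: of_real_power)
  have derf: "(f has_real_derivative Re (2 * poly T (of_real x) * poly (pderiv T) (of_real x))) (at x)" for x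
    unfolding f_def
    by (rule has_field_derivative_Re, rule has_vector_derivative_real_field)
       (auto intro!: derivative_eq_intros)
  then have contf: "continuous_on {a..b} f"
    by (meson DERIV_isCont continuous_at_imp_continuous_on)
  have "\<exists>c\<in>{a..b}. f c \<noteq> 1"
  proof (rule ccontr)
    assume "\<not> ?thesis"
    then have "of_real ` {a..b} \<subseteq> {z. poly (T\<^sup>2 - 1) z = 0}"
      using f by auto
    moreover have "infinite (of_real ` {a..b} :: complex set)"
      using \<open>a < b\<close> by (simp add: finite_image_iff inj_on_def infinite_Icc)
    ultimately have "T\<^sup>2 - 1 = 0"
      using poly_roots_finite finite_subset by blast
    then have "degree (T\<^sup>2) = 0" by simp
    then show False
      using deg by (cases "T = 0") (simp_all add: degree_power_eq)
  qed
  then obtain c where c: "c \<in> {a..b}" "f c > 1"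
    using ge unfolding f_def by force
  obtain x where x: "x \<in> {a..b}" "\<And>t. t \<in> {a..b} \<Longrightarrow> f t \<le> f x"
    using continuous_attains_sup[of "{a..b}" f] contf \<open>a < b\<close> by auto
  have fx: "f x > 1"
    using x(2)[OF c(1)] c(2) by simp
  moreover have "f a = 1" "f b = 1"
    using ab by (simp_all add: f_def)
  ultimately have xab: "a < x" "x < b"
    using x(1) by (auto simp: less_le)
  have "Re (2 * poly T (of_real x) * poly (pderiv T) (of_real x)) = 0"
  proof (rule DERIV_local_max[OF derf])
    show "0 < min (x - a) (b - x)"
      using xab by simp
    show "\<forall>y. \<bar>x - y\<bar> < min (x - a) (b - x) \<longrightarrow> f y \<le> f x"
      by (intro allI impI x(2)) (auto simp: abs_if split: if_splits)
  qed
  moreover have "poly T (of_real x) \<in> \<real>" "poly (pderiv T) (of_real x) \<in> \<real>"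
    using T by (auto intro!: cnj_fixed_poly_Reals simp: map_poly_cnj_pderiv)
  moreover have "poly T (of_real x) \<noteq> 0"
    using f[of x] fx by auto
  ultimately have "poly (pderiv T) (of_real x) = 0"
    by (auto elim!: Reals_cases)
  then show thesis
    using that xab f[of x] fx by auto
qed

section \<open>Disjoint arcs force a zero of \<open>L\<close> outside \<open>[-1,1]\<close>\<close>

theorem theorem7:
  fixes n :: nat and \<alpha> \<beta> :: real and T :: "complex poly" and \<gamma> :: "real \<Rightarrow> complex"
  assumes "n > 0" and "\<alpha> > 0" and "\<beta> > 0"
    and "T_tuple n (-1) 1 (Complex \<alpha> \<beta>) (Complex \<alpha> (-\<beta>))"
    and "T_associated_poly n (-1) 1 (Complex \<alpha> \<beta>) (Complex \<alpha> (-\<beta>)) T"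
    and "arc \<gamma>" and "pathstart \<gamma> = Complex \<alpha> \<beta>" and "pathfinish \<gamma> = Complex \<alpha> (-\<beta>)"
    and "cnj ` path_image \<gamma> = path_image \<gamma>"
    and "poly T -` closed_segment (-1) 1 = closed_segment (-1) 1 \<union> path_image \<gamma>"
    and "\<alpha> \<le> 1"
  shows "path_image \<gamma> \<inter> closed_segment (-1) 1 \<noteq> {}"
proof
  assume disjoint: "path_image \<gamma> \<inter> closed_segment (-1) 1 = {}"
  define H where "H = tuple_quartic \<alpha> \<beta>"
  obtain U where degT: "degree T = n" and U0: "U \<noteq> 0" and degU: "degree U + 2 = n"
    and pell: "T ^ 2 - H * U ^ 2 = 1"
    using assms(5) unfolding T_associated_poly_def H_def tuple_quartic_def by blast
  obtain L where L: "pderiv T = U * L" "smult 2 (T * L) = pderiv H * U + smult 2 (H * pderiv U)"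
    using pell_pderiv_factor[OF pell U0] .
  have seg: "closed_segment (-1) 1 = complex_of_real ` {-1..1}"
    using closed_segment_of_real[of "-1" 1, where 'a = complex] by (simp add: closed_segment_eq_real_ivl)
  have segR: "z \<in> \<real>" if "z \<in> closed_segment (-1) 1" for z :: complex
    using that by (auto simp: seg)
  have T: "map_poly cnj T = T"
  proof (rule real_on_infinite_imp_cnj_eq)
    show "infinite (closed_segment (-1) (1::complex))"
      by (simp add: seg finite_image_iff inj_on_def infinite_Icc)
    show "x \<in> \<real> \<and> poly T x \<in> \<real>" if "x \<in> closed_segment (-1) 1" for x
      using that assms(10) segR by auto
  qed
  have pellx: "(poly T z)\<^sup>2 = 1 + poly H z * (poly U z)\<^sup>2" for z
    using arg_cong[OF pell, of "\<lambda>p. poly p z"] by (simp add: algebra_simps)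
  have H: "map_poly cnj H = H"
    by (rule real_on_infinite_imp_cnj_eq[of "range of_real"])
       (auto simp: H_def poly_tuple_quartic_real infinite_UNIV_char_0 finite_image_iff inj_on_def)
  have H0: "H \<noteq> 0"
    by (auto simp: H_def tuple_quartic_def quartic_poly_def)
  \<comment> \<open>Conjugating the equation determines \<open>U\<close> only up to sign; leading
    coefficients exclude the minus sign.\<close>
  have U: "map_poly cnj U = U"
  proof -
    have "poly (map_poly cnj U ^ 2 * H) z = poly (U ^ 2 * H) z" for z
    proof -
      have "cnj (poly H (cnj z)) = poly H z" "cnj (poly T (cnj z)) = poly T z"
        using poly_cnj[of H "cnj z"] poly_cnj[of T "cnj z"] H T by auto
      then show ?thesis
        using arg_cong[OF pellx[of "cnj z"], of cnj] pellx[of z] by (auto simp: mult.commute)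
    qed
    then have "map_poly cnj U ^ 2 * H = U ^ 2 * H"
      by (rule poly_ext)
    then have "map_poly cnj U = U \<or> map_poly cnj U = - U"
      using H0 by (simp add: power2_eq_iff)
    moreover have "map_poly cnj U \<noteq> - U"
    proof
      assume neg: "map_poly cnj U = - U"
      \<comment> \<open>The sign \<open>-\<close> makes \<open>l\<close> purely imaginary, while
        \<open>l^2\<close> is the square of the real leading coefficient of
        \<open>T\<close>.\<close>
      define l where "l = lead_coeff U"
      have l: "cnj l = - l"
        using arg_cong[OF neg, of "\<lambda>p. coeff p (degree U)"] by (simp add: coeff_map_poly l_def)
      have dH: "lead_coeff H = 1"
        by (simp add: H_def tuple_quartic_def quartic_poly_def)
      have "degree H = 4"
        by (simp add: H_def tuple_quartic_def quartic_poly_def)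
      then have "degree (H * U ^ 2) > 0"
        using H0 U0 by (simp add: degree_mult_eq degree_power_eq)
      moreover have "T ^ 2 = H * U ^ 2 + 1" 
        using pell by (simp add: algebra_simps)
      ultimately have "lead_coeff (T ^ 2) = lead_coeff (H * U ^ 2)"
        by (metis lead_coeff_add_le degree_1 add.commute)
      then have "(lead_coeff T)\<^sup>2 = l\<^sup>2"
        by (simp add: lead_coeff_power lead_coeff_mult dH l_def)
      moreover have "cnj (lead_coeff T) = lead_coeff T"
        using arg_cong[OF T, of "\<lambda>p. coeff p (degree T)"] by (simp add: coeff_map_poly)
      ultimately have "l = 0"
        using l by (auto simp: power2_eq_iff)
      then show False
        using U0 by (simp add: l_def)
    qed
    ultimately show ?thesis by blast
  qed
  have Lc: "map_poly cnj L = L"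
  proof -
    have "U * map_poly cnj L = U * L"
      using L(1) T U by (metis map_poly_cnj_mult map_poly_cnj_pderiv)
    then show ?thesis
      using U0 by simp
  qed
  have dT: "degree (pderiv T) = n - 1"
    by (simp add: degree_pderiv degT)
  then have "L \<noteq> 0"
    using L(1) degU by auto
  \<comment> \<open>\<open>n - 1\<close> exceeds \<open>degree U\<close> by one; the single root of
    \<open>L\<close> is \<open>z*\<close>.\<close>
  then have degL: "degree L = 1"
    using dT degU U0 unfolding L(1) by (simp add: degree_mult_eq)
  obtain y where y: "0 < y" "y < \<beta>"
      "Re (poly L (Complex \<alpha> y) / csqrt (- poly H (Complex \<alpha> y))) = 0"
    using vertical_segment_stationary[of T \<alpha> \<beta> U L] pell L T U assms unfolding H_def by blast
  have roots: False if "\<zeta> < -1 \<or> \<zeta> > 1" "poly L (of_real \<zeta>) = 0" for \<zeta> :: real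
  proof -
    have "[:- of_real \<zeta>, 1:] dvd L"
      using that(2) by (simp add: poly_eq_0_iff_dvd)
    then obtain C where C: "L = [:- of_real \<zeta>, 1:] * C" ..
    then have "C \<noteq> 0"
      using \<open>L \<noteq> 0\<close> by auto
    then have "degree L = degree [:- complex_of_real \<zeta>, 1:] + degree C"
      unfolding C by (intro degree_mult_eq) auto
    then have "degree C = 0"
      using degL by simp
    then obtain c where "C = [:c:]"
      by (rule degree_eq_zeroE)
    with C have Lz: "poly L z = c * (z - of_real \<zeta>)" for z
      by (simp add: algebra_simps)
    have "c \<noteq> 0"
      using C \<open>C = [:c:]\<close> \<open>L \<noteq> 0\<close> by auto
    \<comment> \<open>The slope is real, so it can be pulled out of the real part.\<close>
    have "c = poly L (of_real (\<zeta> + 1))"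
      by (simp add: Lz)
    also have "\<dots> \<in> \<real>"
      using Lc by (rule cnj_fixed_poly_Reals) simp
    finally obtain k where k: "c = of_real k"
      by (auto elim: Reals_cases)
    define q where "q = (Complex \<alpha> y - of_real \<zeta>) / csqrt (- poly H (Complex \<alpha> y))"
    have "Re q \<noteq> 0"
      using Re_divide_sqrt_vertical_neq_0[of \<alpha> y \<beta> \<zeta>] assms y that by (simp add: H_def q_def)
    moreover have "poly L (Complex \<alpha> y) / csqrt (- poly H (Complex \<alpha> y)) = of_real k * q"
      unfolding Lz k q_def by simp
    then have "k * Re q = 0"
      using y(3) by simp
    ultimately show False
      using \<open>c \<noteq> 0\<close> k by simp
  qed
  have ge: "1 \<le> Re ((poly T (of_real x))\<^sup>2)" if "\<bar>x\<bar> \<ge> 1" for x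
  proof -
    obtain u where "poly U (of_real x) = of_real u"
      using cnj_fixed_poly_Reals[OF U, of "of_real x"] by (auto elim: Reals_cases)
    then have "(poly T (of_real x))\<^sup>2 = of_real (1 + (x\<^sup>2 - 1) * ((x - \<alpha>)\<^sup>2 + \<beta>\<^sup>2) * u\<^sup>2)"
      unfolding pellx H_def poly_tuple_quartic_real by simp
    moreover have "0 \<le> (x\<^sup>2 - 1) * ((x - \<alpha>)\<^sup>2 + \<beta>\<^sup>2) * u\<^sup>2"
      using that by (simp add: abs_le_square_iff[of 1 x, simplified])
    ultimately show ?thesis
      by (metis Re_complex_of_real le_add_same_cancel1)
  qed
  \<comment> \<open>The inner product with \<open>\<i>\<close> is the imaginary part, which changes
    sign along the connected arc.\<close>
  have "\<exists>z\<in>path_image \<gamma>. z \<bullet> \<i> = 0"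
    using connected_ivt_component[of "path_image \<gamma>" "Complex \<alpha> (-\<beta>)" "Complex \<alpha> \<beta>" \<i> 0]
      assms(3,6-8) connected_arc_image
      pathstart_in_path_image[of \<gamma>] pathfinish_in_path_image[of \<gamma>] by (auto simp: inner_complex_def)
  then obtain x0 where x0: "of_real x0 \<in> path_image \<gamma>"
    by (metis complex_inner_i_right complex_is_Real_iff Reals_cases)
  have x0out: "\<bar>x0\<bar> > 1"
    using disjoint x0 by (force simp: seg)
  have "poly T (of_real x0) \<in> closed_segment (-1) 1"
    using assms(10) x0 by blast
  then obtain t where t: "poly T (of_real x0) = of_real t" "\<bar>t\<bar> \<le> 1"
    by (auto simp: seg)
  \<comment> \<open>Membership in the preimage gives \<open>t^2 \<le> 1\<close>, and
    \<open>ge\<close> gives the reverse inequality.\<close>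
  have "t\<^sup>2 = 1"
    using ge[of x0] x0out t by (simp add: abs_square_le_1[of t, symmetric] flip: of_real_power)
  then have Tx0: "(poly T (of_real x0))\<^sup>2 = 1"
    by (simp add: t flip: of_real_power)
  have T1: "(poly T (of_real 1))\<^sup>2 = 1" "(poly T (of_real (-1)))\<^sup>2 = 1"
    unfolding pellx H_def poly_tuple_quartic_real by simp_all
  have degT0: "degree T > 0"
    using degT assms(1) by simp
  \<comment> \<open>A zero of \<open>U\<close> would give \<open>T^2 = 1\<close>, so the zero of
    \<open>T' = U L\<close> belongs to \<open>L\<close>.\<close>
  have zero: "poly L z = 0" if "poly (pderiv T) z = 0" "(poly T z)\<^sup>2 \<noteq> 1" for z
    using that pellx[of z] unfolding L(1) by auto
  show False
  proof (cases "x0 > 1")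
    case True
    then obtain x where "1 < x" "poly (pderiv T) (of_real x) = 0" "(poly T (of_real x))\<^sup>2 \<noteq> 1"
      using real_interval_stationary[OF True degT0 T T1(1) Tx0] ge by force
    then show False
      using roots[of x] zero[of "of_real x"] by simp
  next
    case False
    then have "x0 < -1" using x0out by simp
    then obtain x where "x < -1" "poly (pderiv T) (of_real x) = 0" "(poly T (of_real x))\<^sup>2 \<noteq> 1"
      using real_interval_stationary[OF \<open>x0 < -1\<close> degT0 T Tx0 T1(2)] ge by force
    then show False
      using roots[of x] zero[of "of_real x"] by simp
  qed
qed

end
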